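(* For each integer $k \geq 2$, let $(g_{k,n})_{n \geq 0}$ be the $k$-Göbel sequence of rational numbers and let $N_k = \inf\{n \in \mathbb{Z}_{\geq 0} : g_{k,n} \notin \mathbb{Z}\} \in \mathbb{Z}_{\geq 0} \cup \{\infty\}$. Then $\min_{k \geq 2} N_k = 19$; in particular, $g_{k,n} \in \mathbb{Z}$ for every integer $k \geq 2$ and every integer $n$ with $0 \leq n \leq 18$. Moreover, for every integer $k \geq 2$, one has $N_k = 19$ if and only if $k \equiv 6 \pmod{18}$ or $k \equiv 14 \pmod{18}$.
   Context: For an integer $k \geq 2$, the $k$-Göbel sequence $(g_{k,n})_{n \geq 0}$ is the sequence of rational numbers defined by $g_{k,0} = 1$ and $$g_{k,n} = \frac{1}{n}\left(1 + \sum_{j=0}^{n-1} g_{k,j}^k\right) \quad \text{for } n \geq 1.$$ By convention $N_k = \infty$ if $g_{k,n} \in \mathbb{Z}$ for all $n \geq 0$ (that is, $\inf \emptyset = \infty$). *)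

theory Defs
  imports "HOL-Library.Extended_Nat" "HOL-Number_Theory.Cong"
begin

fun goebel :: "nat \<Rightarrow> nat \<Rightarrow> rat" where
  "goebel k 0 = 1"
| "goebel k (Suc n) = (1 / of_nat (Suc n)) * (1 + (\<Sum>j = 0..<Suc n. goebel k j ^ k))"

text \<open>The infimum is taken in \<^typ>\<open>enat\<close>, where the infimum of the empty set is \<open>\<infinity>\<close>.\<close>

definition goebel_N :: "nat \<Rightarrow> enat" where
  "goebel_N k = Inf (enat ` {n. goebel k n \<notin> \<int>})"

end

theory Submission
  imports Defs "HOL-Number_Theory.Number_Theory"
begin

text \<open>
  For \<open>n \<ge> 1\<close> the recursion takes the form \<open>(n + 1) g (n + 1) = n g n + (g n)^k\<close> with \<open>g 1 = 2\<close>. So, as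
  long as the terms up to \<open>g n\<close> are integers, \<open>g (n + 1)\<close> is an integer iff \<open>n + 1\<close> divides the integer
  \<open>n g n + (g n)^k\<close>, and this can be tested one prime \<open>p\<close> at a time. What has to be shown is that for
  \<open>n \<le> 17\<close> the \<open>p\<close>-part of \<open>n + 1\<close> always divides, for all \<open>k\<close>, while for \<open>n = 18\<close> and \<open>p = 19\<close> the answer
  depends on \<open>k\<close> modulo \<open>18\<close>.

  Knowing \<open>g n\<close> modulo \<open>M\<close> gives \<open>g (n + 1)\<close> modulo \<open>M / gcd M (n + 1)\<close>. Starting from \<open>g 1 = 2\<close> modulo
  the \<open>p\<close>-part \<open>p^e\<close> of \<open>18!\<close>, one therefore runs out of precision only after the last multiple of \<open>p\<close>
  up to \<open>18\<close>. Powers modulo \<open>p^e\<close> depend on \<open>k\<close> only modulo \<open>p^(e - 1) (p - 1)\<close> once \<open>k \<ge> e\<close>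
  (\<open>exponent_representative\<close>), so for each \<open>p\<close> finitely many exponents have to be followed
  (\<open>goebel_mod_sound\<close>). For \<open>p = 5, 7, 11, 13, 17, 19\<close> these are at most about a hundred, and they are
  run through by rewriting; for \<open>p = 19\<close> one starts modulo \<open>19\<close> and reaches \<open>g 18\<close> without any loss.

  For \<open>p = 2\<close> and \<open>p = 3\<close> there would be thousands of classes, and an argument replaces their enumeration.

  \<^item> \<open>p = 2\<close>: for \<open>k \<ge> 16\<close> the second term \<open>1 + 2^(k - 1)\<close> is so close to \<open>1\<close> that the whole sequence
    stays 2-adically near the constant solution \<open>1\<close> of the recursion (\<open>two_part_large_exponent\<close>). The
    exponents \<open>k < 16\<close> are run through.

  \<^item> \<open>p = 3\<close>: one argues modulo \<open>9\<close> by the class of \<open>k\<close> modulo \<open>6\<close> (\<open>three_part\<close>). If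
    \<open>(g n)^(k - 1) \<equiv> 1\<close> modulo \<open>9\<close>, then \<open>n g n + (g n)^k \<equiv> (n + 1) g n\<close> and division is harmless
    (\<open>flat_step\<close>). If \<open>k \<ge> 3\<close> and \<open>27\<close> divides \<open>n g n\<close>, call the sequence dead: then \<open>m g m\<close> stays
    divisible by \<open>27\<close> for all later \<open>m \<le> 18\<close> (\<open>dead_persists\<close>), again harmless. For \<open>k \<equiv> 0, 2, 5\<close> modulo \<open>6\<close> the decisive fact is that
    from \<open>n = 3 u\<close> to \<open>n = 3 u + 2\<close> the map contracts: if \<open>g (3 u)\<close> is a unit at \<open>3\<close>, then whatever information about \<open>g (3 u)\<close> modulo \<open>9\<close> was
    lost by the last division, \<open>g (3 u + 2)\<close> is \<open>\<plusminus>1\<close> modulo \<open>9\<close> (\<open>contraction\<close>), just in time for the next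
    division by \<open>3\<close> or \<open>9\<close>.
\<close>


section \<open>Powers modulo prime powers\<close>

lemma power_cong_exponent:
  fixes a :: int
  assumes p: "prime p" and e: "0 < e" "e \<le> i" "e \<le> j"
    and ij: "[i = j] (mod p ^ (e - 1) * (p - 1))"
  shows "[a ^ i = a ^ j] (mod int p ^ e)"
proof (cases "int p dvd a")
  case True
  have "int p ^ e dvd a ^ m" if "e \<le> m" for m
    using True that by (meson dvd_trans dvd_power_same le_imp_power_dvd)
  with e show ?thesis by (simp add: cong_def mod_eq_0_iff_dvd)
next
  case False
  define t where "t = p ^ (e - 1) * (p - 1)"
  have "coprime a (int p ^ e)"
    using False p by (metis coprime_commute coprime_power_right_iff prime_imp_coprime prime_nat_int_transfer)
  then have "[a ^ totient (nat (int p ^ e)) = 1] (mod int p ^ e)"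
    using residues.euler_theorem[of "int p ^ e" a] one_less_power[of "int p" e] prime_gt_1_nat[OF p] e
    by (simp add: residues_def)
  moreover have "totient (nat (int p ^ e)) = t"
    using p e by (simp add: totient_prime_power t_def nat_power_eq)
  ultimately have one: "[a ^ t = 1] (mod int p ^ e)" by simp
  have *: "[a ^ i = a ^ j] (mod int p ^ e)" if "i \<le> j" "[i = j] (mod t)" for i j
  proof -
    from that have "t dvd j - i"
      using cong_altdef_nat cong_sym by blast
    then obtain s where s: "j = i + t * s"
      using \<open>i \<le> j\<close> by (metis dvdE le_add_diff_inverse)
    have "[a ^ i * (a ^ t) ^ s = a ^ i * 1 ^ s] (mod int p ^ e)"
      by (intro cong_mult cong_pow one cong_refl)
    then show ?thesis by (simp add: s power_add power_mult cong_sym)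
  qed
  show ?thesis
  proof (cases "i \<le> j")
    case True then show ?thesis using * ij by (simp add: t_def)
  next
    case False then show ?thesis using *[of j i] ij by (simp add: t_def cong_sym)
  qed
qed

text \<open>The lower bound \<open>c\<close> is kept apart from \<open>e\<close> so that the representatives are themselves admissible
  exponents, that is at least \<open>2\<close>, also when \<open>e = 1\<close>.\<close>

lemma exponent_representative:
  assumes p: "prime p" and e: "0 < e" "e \<le> c" and c: "2 \<le> c" and k: "2 \<le> k"
  obtains \<kappa> where "\<kappa> \<in> {2..<c + p ^ (e - 1) * (p - 1)}" "[k = \<kappa>] (mod p ^ (e - 1) * (p - 1))"
    "\<And>x :: int. [x ^ k = x ^ \<kappa>] (mod int p ^ e)"
proof (cases "k < c + p ^ (e - 1) * (p - 1)")
  case True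
  then show ?thesis using that[of k] k by simp
next
  case False
  define t where "t = p ^ (e - 1) * (p - 1)"
  have t: "0 < t" using p by (simp add: t_def prime_gt_0_nat prime_gt_Suc_0_nat)
  define \<kappa> where "\<kappa> = c + (k - c) mod t"
  have "[c + (k - c) = \<kappa>] (mod t)"
    unfolding \<kappa>_def by (intro cong_add cong_refl) (simp add: cong_def)
  then have cong: "[k = \<kappa>] (mod t)" using False by (simp add: t_def)
  show ?thesis
  proof (rule that[of \<kappa>])
    show "\<kappa> \<in> {2..<c + p ^ (e - 1) * (p - 1)}"
      using t c by (simp add: \<kappa>_def t_def)
    show "[x ^ k = x ^ \<kappa>] (mod int p ^ e)" for x :: int
      using False e cong by (intro power_cong_exponent p) (auto simp: \<kappa>_def t_def)
  qed (use cong t_def in simp)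
qed

lemma unit_power_mod_9:
  fixes a :: int
  assumes "\<not> 3 dvd a"
  shows "a ^ m mod 9 = (a mod 9) ^ (m mod 6) mod 9"
proof -
  have "a mod 9 \<in> {1, 2, 4, 5, 7, 8}" using assms by simp presburger
  then have "(a mod 9) ^ 6 mod 9 = 1" by auto
  then have "[a ^ 6 = 1] (mod 9)" by (simp add: cong_def power_mod)
  then have "[(a ^ 6) ^ (m div 6) * a ^ (m mod 6) = 1 ^ (m div 6) * a ^ (m mod 6)] (mod 9)"
    by (intro cong_mult cong_pow cong_refl)
  moreover have "(a ^ 6) ^ (m div 6) * a ^ (m mod 6) = a ^ m"
    by (simp flip: power_mult power_add)
  ultimately show ?thesis by (simp add: cong_def power_mod)
qed

lemma coprime_9_iff: "coprime 9 x \<longleftrightarrow> \<not> 3 dvd x" for x :: int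
proof
  assume "\<not> 3 dvd x"
  then have "coprime (3 ^ 2) x"
    using prime_imp_coprime[of "3 :: int"] by (intro coprime_power_left_iff[THEN iffD2]) simp
  then show "coprime 9 x" by simp
next
  assume "coprime 9 x"
  show "\<not> 3 dvd x"
  proof
    assume "3 dvd x"
    then have "is_unit (3 :: int)"
      using \<open>coprime 9 x\<close> by (intro coprime_common_divisor[of 9 x 3]) simp_all
    then show False by simp
  qed
qed

section \<open>Integral initial segments\<close>

text \<open>The terms of an integral initial segment, as integers. The last index \<open>N\<close> is where divisibility of
  \<open>N * G N + G N ^ k\<close> by \<open>N + 1\<close> is still to be decided.\<close>

locale goebel_prefix =
  fixes k N :: nat and G :: "nat \<Rightarrow> int"
  assumes k: "2 \<le> k" and G1: "G 1 = 2"
    and rec: "\<And>n. 1 \<le> n \<Longrightarrow> n < N \<Longrightarrow> (int n + 1) * G (n + 1) = int n * G n + G n ^ k"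
begin

definition numer :: "nat \<Rightarrow> int" where "numer n = int n * G n + G n ^ k"

lemma rec_numer: "1 \<le> n \<Longrightarrow> n < N \<Longrightarrow> (int n + 1) * G (n + 1) = numer n"
  unfolding numer_def by (rule rec)

lemma twice_G2: "2 \<le> N \<Longrightarrow> 2 * G 2 = 2 + 2 ^ k"
  using rec[of 1] unfolding G1 nat_1_add_1 by simp

lemma G2: "2 \<le> N \<Longrightarrow> G 2 = 1 + 2 ^ (k - 1)"
  using twice_G2 k by (cases k) auto

lemma G2_mod_9: "2 \<le> N \<Longrightarrow> G 2 mod 9 = (1 + 2 ^ ((k - 1) mod 6)) mod 9"
  using unit_power_mod_9[of 2 "k - 1"] by (simp add: G2 mod_add_right_eq)
    (metis mod_add_right_eq)

lemma pred_mod_6: "0 < k mod 6 \<Longrightarrow> (k - 1) mod 6 = k mod 6 - 1"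
  by (cases k) (auto simp: mod_Suc split: if_splits)

section \<open>Divisibility by powers of 2 for large exponents\<close>

text \<open>The constant sequence \<open>1\<close> satisfies the recursion, and \<open>(n + 1) (G (n + 1) - 1)\<close> is a multiple of
  \<open>G n - 1\<close>. So \<open>n! (G n - 1)\<close> never loses the factor \<open>2^16\<close> that it has at \<open>n = 2\<close>,
  and \<open>18!\<close> contains only \<open>2^16\<close>: there is always enough precision left for the factor \<open>n + 1\<close>.\<close>

lemma two_part_large_exponent:
  assumes "16 \<le> k" "1 \<le> n" "n \<le> N" "n \<le> 17"
  shows "gcd (2 ^ 16) (int n + 1) dvd numer n"
proof (cases "n = 1")
  case True
  have "even (numer 1)" using k by (simp add: numer_def G1)
  then show ?thesis using True by simp
next
  case False
  have inv: "2 ^ 16 dvd fact m * (G m - 1)" if "2 \<le> m" "m \<le> N" for m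
    using that
  proof (induction m rule: dec_induct)
    case base
    then have "2 * G 2 = 2 + 2 ^ k" by (rule twice_G2)
    moreover have "fact 2 * (G 2 - 1) = 2 * G 2 - (2 :: int)" by (simp add: algebra_simps)
    ultimately have "fact 2 * (G 2 - 1) = 2 ^ k" by linarith
    then show ?case using le_imp_power_dvd[OF assms(1), of "2 :: int"] by metis
  next
    case (step m)
    have "fact (Suc m) * (G (Suc m) - 1) = fact m * ((int m + 1) * G (m + 1) - (int m + 1))"
      by (simp add: algebra_simps)
    also have "\<dots> = fact m * (int m * (G m - 1) + (G m ^ k - 1))"
      using step rec[of m] by (simp add: algebra_simps)
    finally have eq: "fact (Suc m) * (G (Suc m) - 1) = fact m * (int m * (G m - 1) + (G m ^ k - 1))" .
    have "G m - 1 dvd G m ^ k - 1"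
      using power_diff_1_eq[of "G m" k] by simp
    then have "fact m * (G m - 1) dvd fact m * (int m * (G m - 1) + (G m ^ k - 1))"
      by (intro mult_dvd_mono dvd_add) auto
    then show ?case unfolding eq using step by (meson Suc_leD dvd_trans)
  qed
  \<comment> \<open>The recursion at the constant \<open>1\<close> has numerator \<open>n + 1\<close>; it suffices to bound the deviation from it.\<close>
  define Y where "Y = numer n - (int n + 1)"
  have d: "gcd (2 ^ 16) (int n + 1) dvd Y"
  proof (cases "Y = 0")
    case nz: False
    let ?v = "multiplicity (2 :: int)"
    have "G n - 1 dvd Y"
    proof -
      have "Y = int n * (G n - 1) + (G n ^ k - 1)" by (simp add: Y_def numer_def algebra_simps)
      then show ?thesis using power_diff_1_eq[of "G n" k] by simp
    qed
    then have "fact n * (G n - 1) dvd fact n * Y"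
      by (intro mult_dvd_mono) simp_all
    moreover have "2 ^ 16 dvd fact n * (G n - 1)"
      using False assms by (intro inv) simp_all
    ultimately have "2 ^ 16 dvd fact n * Y"
      by (rule dvd_trans[rotated])
    then have "16 \<le> ?v (fact n * Y)" using nz by (intro multiplicity_geI) auto
    then have 1: "16 \<le> ?v (fact n) + ?v Y"
      using nz by (simp add: prime_elem_multiplicity_mult_distrib)
    \<comment> \<open>The powers of \<open>2\<close> in \<open>n!\<close> and in \<open>n + 1\<close> together make up at most \<open>2^16\<close>.\<close>
    have "\<not> 2 ^ 17 dvd (fact 18 :: int)" by (simp add: fact_numeral)
    then have "\<not> 2 ^ 17 dvd (fact (Suc n) :: int)"
      using dvd_trans[OF _ fact_dvd[of "Suc n" 18]] assms(4) by fastforce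
    then have "?v (fact (Suc n)) < 17"
      by (meson multiplicity_dvd' not_le)
    moreover have "(fact (Suc n) :: int) = fact n * (int n + 1)" by simp
    ultimately have 2: "?v (fact n) + ?v (int n + 1) < 17"
      by (simp add: prime_elem_multiplicity_mult_distrib del: fact_Suc)
    obtain j where j: "gcd (2 ^ 16) (int n + 1) = 2 ^ j"
      using divides_primepow[of "2 :: int" "gcd (2 ^ 16) (int n + 1)" 16] by auto
    then have "2 ^ j dvd int n + 1" by (metis gcd_dvd2)
    then have "j \<le> ?v (int n + 1)" by (intro multiplicity_geI) auto
    then show ?thesis unfolding j using 1 2 by (intro multiplicity_dvd') simp
  qed simp
  have "numer n = Y + (int n + 1)" by (simp add: Y_def)
  then show ?thesis using d by simp
qed

section \<open>Divisibility by 3 and 9\<close>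

text \<open>Here the recursion is \<open>G (n + 1) \<equiv> G n\<close> after cancelling \<open>n + 1\<close>. When \<open>9\<close> divides \<open>n + 1\<close>, the
  cancellation leaves no information on \<open>G (n + 1)\<close>.\<close>

lemma flat_step:
  assumes n: "1 \<le> n" and one: "[G n ^ (k - 1) = 1] (mod 9)"
  shows "gcd 9 (int n + 1) dvd numer n"
    and "n < N \<Longrightarrow> \<not> 9 dvd int n + 1 \<Longrightarrow> [G (n + 1) = G n] (mod 3)"
proof -
  have "G n ^ k = G n * G n ^ (k - 1)"
    using k by (simp flip: power_Suc)
  then have "numer n = G n * (int n + G n ^ (k - 1))"
    by (simp add: numer_def algebra_simps)
  also have "[\<dots> = G n * (int n + 1)] (mod 9)"
    by (intro cong_mult cong_add cong_refl one)
  finally have X9: "[numer n = (int n + 1) * G n] (mod 9)" by (simp add: mult.commute)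
  show "gcd 9 (int n + 1) dvd numer n"
    using cong_dvd_iff[OF cong_dvd_modulus[OF X9, of "gcd 9 (int n + 1)"]] by simp
  assume "n < N" and n9: "\<not> 9 dvd int n + 1"
  then have "[(int n + 1) * G (n + 1) = (int n + 1) * G n] (mod 9)"
    using X9 rec_numer[OF n] by simp
  then have dvd: "9 dvd (int n + 1) * (G (n + 1) - G n)"
    by (simp add: cong_iff_dvd_diff right_diff_distrib)
  have "3 dvd G (n + 1) - G n"
  proof (rule ccontr)
    assume "\<not> 3 dvd G (n + 1) - G n"
    then show False using dvd n9 by (simp add: coprime_dvd_mult_left_iff flip: coprime_9_iff)
  qed
  then show "[G (n + 1) = G n] (mod 3)" by (simp add: cong_iff_dvd_diff)
qed

lemma divisible_by_3_of_27:
  assumes "27 dvd int m * G m" "1 \<le> m" "m \<le> 18"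
  shows "3 dvd G m"
proof (rule ccontr)
  assume "\<not> 3 dvd G m"
  then have "coprime (3 ^ 3) (G m)"
    using prime_imp_coprime[of "3 :: int"] by (intro coprime_power_left_iff[THEN iffD2]) simp
  then have "27 dvd int m" using assms(1) by (simp add: coprime_dvd_mult_left_iff)
  then show False using assms(2,3) zdvd_imp_le by fastforce
qed

lemma dead_numer:
  assumes "3 \<le> k" "27 dvd int m * G m" "1 \<le> m" "m \<le> 18"
  shows "27 dvd numer m"
proof -
  have "3 ^ 3 dvd G m ^ 3"
    using divisible_by_3_of_27 assms by (intro dvd_power_same) simp
  also have "G m ^ 3 dvd G m ^ k" using assms(1) by (rule le_imp_power_dvd)
  finally show ?thesis using assms(2) by (simp add: numer_def)
qed

text \<open>For \<open>m \<le> 18\<close> the factor \<open>m\<close> contributes at most \<open>3^2\<close>, so \<open>27 dvd m * G m\<close> forces \<open>3 dvd G m\<close>; for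
  \<open>k \<ge> 3\<close> the summand \<open>G m ^ k\<close> is then invisible modulo \<open>27\<close>, and \<open>m * G m\<close> is conserved.\<close>

lemma dead_persists:
  assumes "3 \<le> k" "27 dvd int n * G n" "1 \<le> n" "n \<le> m" "m \<le> N" "m \<le> 18"
  shows "27 dvd int m * G m"
  using assms(4,1-3,5,6)
proof (induction m rule: dec_induct)
  case (step m)
  then have "27 dvd numer m" by (intro dead_numer) auto
  then show ?case using rec_numer[of m] step by (simp add: add.commute)
qed simp

lemma dead:
  assumes "3 \<le> k" "27 dvd int n * G n" "1 \<le> n" "n \<le> m" "m \<le> N" "m \<le> 18"
  shows "gcd 9 (int m + 1) dvd numer m"
proof -
  have "27 dvd numer m" using assms dead_persists by (intro dead_numer) auto
  moreover have "gcd 9 (int m + 1) dvd (27 :: int)"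
    by (rule dvd_trans[OF gcd_dvd1]) simp
  ultimately show ?thesis by (rule dvd_trans[rotated])
qed

text \<open>All powers \<open>G n ^ (k - 1)\<close> of units are \<open>1\<close> modulo \<open>9\<close>, so every step is flat as long as \<open>G n\<close> is
  a unit at \<open>3\<close>. It can cease to be one only where \<open>9\<close> is divided out, and then the sequence is dead.\<close>

lemma three_part_unit_powers:
  assumes "3 \<le> k" "k mod 6 = 1" "1 \<le> n" "n \<le> N" "n \<le> 17"
  shows "gcd 9 (int n + 1) dvd numer n"
proof -
  have k6: "(k - 1) mod 6 = 0" using assms(2) pred_mod_6 by simp
  have one: "[G m ^ (k - 1) = 1] (mod 9)" if "\<not> 3 dvd G m" for m
    using unit_power_mod_9[OF that, of "k - 1"] k6 by (simp add: cong_def)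
  have "\<not> 3 dvd G m \<or> 27 dvd int m * G m" if "1 \<le> m" "m \<le> N" "m \<le> 17" for m
    using that
  proof (induction m rule: dec_induct)
    case base
    then show ?case using G1 by simp
  next
    case (step m)
    consider "27 dvd int m * G m" | "\<not> 3 dvd G m" "9 dvd int m + 1" | "\<not> 3 dvd G m" "\<not> 9 dvd int m + 1"
      using step by auto
    then show ?case
    proof cases
      case 1
      then show ?thesis using dead_persists[of m "Suc m"] step assms by simp
    next
      case 2
      then show ?thesis using mult_dvd_mono[of 9 "int m + 1" 3 "G (Suc m)"] by (auto simp: add.commute)
    next
      case 3
      then show ?thesis
        using flat_step(2)[of m, OF _ one] step by (simp add: cong_dvd_iff[of "G (Suc m)" "G m" 3])
    qed
  qed
  then consider "\<not> 3 dvd G n" | "27 dvd int n * G n" using assms by auto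
  then show ?thesis
  proof cases
    case 1 then show ?thesis using flat_step(1) one assms by simp
  next
    case 2 then show ?thesis using dead[of n n] assms by simp
  qed
qed

text \<open>The sequence dies at once, because \<open>27\<close> divides \<open>3 * G 3\<close>. Since \<open>27\<close> has to be seen, \<open>k\<close>
  is needed modulo \<open>18\<close>; the three classes are checked separately.\<close>

lemma three_part_dead:
  assumes "3 \<le> k" "k mod 6 = 3" "1 \<le> n" "n \<le> N" "n \<le> 17"
  shows "gcd 9 (int n + 1) dvd numer n"
proof (cases "n = 1")
  case True then show ?thesis by simp
next
  case False
  then have N: "2 \<le> N" using assms by simp
  have k18: "k mod 18 = 3 \<or> k mod 18 = 9 \<or> k mod 18 = 15"
  proof -
    have "k mod 18 mod 6 = 3" using assms(2) by (simp add: mod_mod_cancel)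
    moreover have "k mod 18 < 18" by simp
    moreover have "x = 3 \<or> x = 9 \<or> x = 15" if "x mod 6 = 3" "x < 18" for x :: nat
      using that by presburger
    ultimately show ?thesis by blast
  qed
  have red: "a ^ k mod 27 = (a mod 27) ^ (k mod 18) mod 27" for a :: int
  proof -
    have "[a ^ k = a ^ (k mod 18)] (mod int 3 ^ 3)"
      using assms(1) k18 by (intro power_cong_exponent) (auto simp: cong_def)
    then show ?thesis by (simp add: cong_def power_mod)
  qed
  have X2: "27 dvd numer 2"
  proof -
    \<comment> \<open>\<open>14\<close> is the inverse of \<open>2\<close> modulo \<open>27\<close>.\<close>
    have "[G 2 = 14 * (2 * G 2)] (mod 27)" by (simp add: cong_iff_dvd_diff)
    also have "[14 * (2 * G 2) = 14 * (2 + 2 ^ k mod 27)] (mod 27)"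
      unfolding twice_G2[OF N] by (intro cong_mult cong_add cong_refl) (simp add: cong_def)
    finally have g: "G 2 mod 27 = 14 * (2 + 2 ^ k mod 27) mod 27" by (simp only: cong_def)
    have "[numer 2 = 2 * (G 2 mod 27) + G 2 ^ k mod 27] (mod 27)"
      unfolding numer_def of_nat_numeral by (intro cong_add cong_mult cong_refl) (simp_all add: cong_def)
    then have numer: "numer 2 mod 27 = (2 * (G 2 mod 27) + G 2 ^ k mod 27) mod 27"
      by (simp only: cong_def)
    from k18 have "numer 2 mod 27 = 0"
    proof (elim disjE, goal_cases)
      case 1
      have P: "2 ^ k mod 27 = (8 :: int)" using red[of 2] unfolding 1 by simp
      have G: "G 2 mod 27 = 5" unfolding g P by simp
      have Q: "G 2 ^ k mod 27 = 17" using red[of "G 2"] unfolding G 1 by simp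
      show ?thesis unfolding numer G Q by simp
    next
      case 2
      have P: "2 ^ k mod 27 = (26 :: int)" using red[of 2] unfolding 2 by simp
      have G: "G 2 mod 27 = 14" unfolding g P by simp
      have Q: "G 2 ^ k mod 27 = 26" using red[of "G 2"] unfolding G 2 by simp
      show ?thesis unfolding numer G Q by simp
    next
      case 3
      have P: "2 ^ k mod 27 = (17 :: int)" using red[of 2] unfolding 3 by simp
      have G: "G 2 mod 27 = 23" unfolding g P by simp
      have Q: "G 2 ^ k mod 27 = 8" using red[of "G 2"] unfolding G 3 by simp
      show ?thesis unfolding numer G Q by simp
    qed
    then show ?thesis by (rule mod_0_imp_dvd)
  qed
  show ?thesis
  proof (cases "n = 2")
    case True
    have "gcd 9 (int 2 + 1) dvd (27 :: int)" by simp
    then show ?thesis unfolding True using X2 by (rule dvd_trans)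
  next
    case n: False
    then have "2 < N" using False assms(3,4) by linarith
    then have "27 dvd int 3 * G 3" using X2 rec_numer[of 2] by simp
    then show ?thesis using dead[of 3 n] n False assms by simp
  qed
qed

text \<open>Since \<open>2^(k - 1) \<equiv> 8\<close> modulo \<open>9\<close>, \<open>G 2\<close> is divisible by \<open>9\<close>, and up to \<open>n = 9\<close> the product \<open>n * G n\<close> keeps this factor. The sequence
  either dies at \<open>9\<close> or wakes up with a unit of arbitrary residue. In the latter case \<open>G 9 ^ k\<close>, whose
  exponent is even, pushes \<open>G 10\<close> into the class \<open>1\<close> modulo \<open>3\<close>, and since \<open>3\<close> divides \<open>k - 1\<close> all steps from
  there on are flat.\<close>

lemma three_part_dormant:
  assumes "3 \<le> k" "k mod 6 = 4" "1 \<le> n" "n \<le> N" "n \<le> 17"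
  shows "gcd 9 (int n + 1) dvd numer n"
proof (cases "n = 1")
  case True then show ?thesis by simp
next
  case False
  have k6: "(k - 1) mod 6 = 3" using assms(2) pred_mod_6 by simp
  have X9: "9 dvd numer m" if "9 dvd int m * G m" "1 \<le> m" "m \<le> 8" for m
  proof -
    have "3 dvd G m"
    proof (rule ccontr)
      assume "\<not> 3 dvd G m"
      then have "9 dvd int m" using that(1) by (simp add: coprime_9_iff coprime_dvd_mult_left_iff)
      then show False using that(2,3) zdvd_imp_le by fastforce
    qed
    then have "3 ^ 2 dvd G m ^ 2" by (intro dvd_power_same)
    also have "G m ^ 2 dvd G m ^ k" using k by (rule le_imp_power_dvd)
    finally show ?thesis using that(1) by (simp add: numer_def)
  qed
  have nine: "9 dvd int m * G m" if "2 \<le> m" "m \<le> N" "m \<le> 9" for m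
    using that
  proof (induction m rule: dec_induct)
    case base
    have "G 2 mod 9 = 0" using G2_mod_9[OF \<open>2 \<le> N\<close>] unfolding k6 by simp
    then have "9 dvd G 2" by (rule mod_0_imp_dvd)
    then show ?case by simp
  next
    case (step m)
    then show ?case using X9[of m] rec_numer[of m] by (simp add: add.commute)
  qed
  consider "n \<le> 8" | "9 \<le> n" "3 dvd G 9" | "n = 9" | "10 \<le> n" "\<not> 3 dvd G 9" by linarith
  then show ?thesis
  proof cases
    case 1
    then have "9 dvd numer n" using X9 nine assms False by simp
    then show ?thesis by (rule dvd_trans[OF gcd_dvd1])
  next
    case 2
    then have "27 dvd int 9 * G 9" using mult_dvd_mono[of 9 9 3 "G 9"] by simp
    then show ?thesis using dead[of 9 n] 2 assms by simp
  next
    case 3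
    then show ?thesis by (simp add: gcd_non_0_int)
  next
    case 4
    have one: "[G m ^ (k - 1) = 1] (mod 9)" if "[G m = 1] (mod 3)" for m
    proof -
      have "G m mod 9 \<in> {1, 4, 7}" "\<not> 3 dvd G m" using that by (simp_all add: cong_def) presburger+
      then show ?thesis using unit_power_mod_9[of "G m" "k - 1"] k6 by (auto simp: cong_def)
    qed
    have "[G m = 1] (mod 3)" if "10 \<le> m" "m \<le> N" "m \<le> 17" for m
      using that
    proof (induction m rule: dec_induct)
      case base
      have "G 9 ^ k mod 9 = (G 9 mod 9) ^ 4 mod 9"
        using unit_power_mod_9[of "G 9" k] 4 assms(2) by simp
      moreover have "G 9 mod 9 \<in> {1, 2, 4, 5, 7, 8}" using 4 by simp presburger
      ultimately have "G 9 ^ k mod 9 \<in> {1, 4, 7}" by auto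
      then have "G 9 ^ k mod 3 = 1" by simp presburger
      moreover have "10 * G 10 = 9 * G 9 + G 9 ^ k" using rec[of 9] base by simp
      moreover have "x mod 3 = 1" if "z mod 3 = 1" "10 * x = 9 * y + z" for x y z :: int
        using that by presburger
      ultimately have "G 10 mod 3 = 1" by blast
      then show ?case by (simp add: cong_def)
    next
      case (step m)
      then have IH: "[G m = 1] (mod 3)" by simp
      have "\<not> 9 dvd int m + 1" using \<open>10 \<le> m\<close> \<open>Suc m \<le> 17\<close> by presburger
      then have "[G (m + 1) = G m] (mod 3)"
        using step(1,4) by (intro flat_step(2) one IH) simp_all
      from cong_trans[OF this IH] show ?case by simp
    qed
    then have "[G n = 1] (mod 3)" using 4 assms(4,5) by blast
    then show ?thesis using assms(3) by (intro flat_step(1) one)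
  qed
qed

text \<open>Modulo \<open>9\<close> the inverses of \<open>3 u + 1\<close> and \<open>3 u + 2\<close> are \<open>6 u + 1\<close> and \<open>6 u + 5\<close>, so \<open>b\<close> and \<open>c\<close> are the
  residues of \<open>G (3 u + 1)\<close> and \<open>G (3 u + 2)\<close> when \<open>a\<close> is that of \<open>G (3 u)\<close> and \<open>r = k mod 6\<close>. The reason for the
  contraction is that \<open>a = \<plusminus>(1 + 3 s)\<close> leads to \<open>a ^ r = \<plusminus>(1 + 3 r s)\<close>, and for \<open>r \<equiv> 2\<close> modulo \<open>3\<close> the
  contributions of \<open>s\<close> from the two steps add up to \<open>9 s\<close>, while for \<open>r = 0\<close> the
  first step already removes \<open>s\<close>. For even \<open>r\<close> a start in the class \<open>2\<close> modulo \<open>3\<close> need not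
  contract. It is admitted only at \<open>u = 3\<close>, because the division by \<open>9\<close> leaves the class of \<open>G 9\<close> open, and at
  \<open>u = 1\<close> for \<open>r = 2\<close>, where \<open>G 3\<close> is in that class.\<close>

lemma contraction_residues:
  "\<forall>u\<in>set [1, 2, 3, 4, 5 :: int]. \<forall>a\<in>set [1, 2, 4, 5, 7, 8 :: int]. \<forall>r\<in>set [0, 2, 5 :: nat].
     r = 5 \<or> a mod 3 = 1 \<or> u = 3 \<or> r = 2 \<and> u = 1 \<longrightarrow>
     \<comment> \<open>Quantifying over singletons makes rewriting evaluate \<open>b\<close> and \<open>c\<close> once.\<close>
     (\<forall>b\<in>set [(6 * u + 1) * (3 * u * a + a ^ r) mod 9]. b mod 3 \<noteq> 0 \<and>
       (\<forall>c\<in>set [(6 * u + 5) * ((3 * u + 1) * b + b ^ r) mod 9]. c = 1 \<or> r = 5 \<and> c = 8))"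
  by code_simp

lemma numer_mod_9:
  assumes "\<not> 3 dvd G m"
  shows "[numer m = int m * (G m mod 9) + (G m mod 9) ^ (k mod 6)] (mod 9)"
  unfolding numer_def using unit_power_mod_9[OF assms, of k]
  by (intro cong_add cong_mult cong_refl) (simp_all add: cong_def)

lemma G_next_mod_9:
  assumes "1 \<le> m" "m < N" "[v * (int m + 1) = 1] (mod 9)"
  shows "[G (m + 1) = v * numer m] (mod 9)"
proof -
  have "[v * (int m + 1) * G (m + 1) = 1 * G (m + 1)] (mod 9)"
    using assms(3) by (intro cong_mult cong_refl)
  then show ?thesis by (simp add: rec_numer[OF assms(1,2), symmetric] mult.assoc cong_sym)
qed

lemma contraction:
  assumes k: "k mod 6 \<in> {0, 2, 5}" and u: "1 \<le> u" "u \<le> 5" and N: "3 * u + 2 \<le> N"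
    and unit: "\<not> 3 dvd G (3 * u)"
    and start: "k mod 6 = 5 \<or> G (3 * u) mod 3 = 1 \<or> u = 3 \<or> k mod 6 = 2 \<and> u = 1"
  shows "G (3 * u + 2) mod 9 = 1 \<or> k mod 6 = 5 \<and> G (3 * u + 2) mod 9 = 8"
proof -
  define U where "U = int u"
  define a where "a = G (3 * u) mod 9"
  define b where "b = (6 * U + 1) * (3 * U * a + a ^ (k mod 6)) mod 9"
  define c where "c = (6 * U + 5) * ((3 * U + 1) * b + b ^ (k mod 6)) mod 9"
  have inv1: "[(6 * U + 1) * (int (3 * u) + 1) = 1] (mod 9)"
    and inv2: "[(6 * U + 5) * (int (3 * u + 1) + 1) = 1] (mod 9)"
    by (simp_all add: cong_iff_dvd_diff U_def algebra_simps)
  have U: "U \<in> set [1, 2, 3, 4, 5]" using u by (auto simp: U_def)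
  have a: "a \<in> set [1, 2, 4, 5, 7, 8]" using unit by (simp add: a_def) presburger
  have "a mod 3 = G (3 * u) mod 3" by (simp add: a_def mod_mod_cancel)
  then have "k mod 6 = 5 \<or> a mod 3 = 1 \<or> U = 3 \<or> k mod 6 = 2 \<and> U = 1"
    using start by (auto simp: U_def)
  then have bc: "b mod 3 \<noteq> 0" "c = 1 \<or> k mod 6 = 5 \<and> c = 8"
    using contraction_residues[rule_format, OF U a, of "k mod 6"] k unfolding b_def c_def by simp_all
  have "[G (3 * u + 1) = (6 * U + 1) * numer (3 * u)] (mod 9)"
    using u N by (intro G_next_mod_9 inv1) auto
  also have "[(6 * U + 1) * numer (3 * u) = (6 * U + 1) * (3 * U * a + a ^ (k mod 6))] (mod 9)"
    using numer_mod_9[OF unit] by (intro cong_mult cong_refl) (simp add: a_def U_def)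
  finally have b: "G (3 * u + 1) mod 9 = b" by (simp add: cong_def b_def)
  then have unit1: "\<not> 3 dvd G (3 * u + 1)" using bc(1) by auto presburger
  have "[G (3 * u + 1 + 1) = (6 * U + 5) * numer (3 * u + 1)] (mod 9)"
    using u N by (intro G_next_mod_9 inv2) auto
  also have "[(6 * U + 5) * numer (3 * u + 1) = (6 * U + 5) * ((3 * U + 1) * b + b ^ (k mod 6))] (mod 9)"
    using numer_mod_9[OF unit1] b by (intro cong_mult cong_refl) (simp add: U_def add.commute)
  finally have "G (3 * u + 2) mod 9 = c" by (simp add: cong_def c_def)
  then show ?thesis using bc(2) by simp
qed

text \<open>The invariant \<open>ok u\<close> says that at \<open>n = 3 u\<close> the sequence is dead or is a unit at which \<open>contraction\<close>
  applies. Contraction makes the step from \<open>3 u + 2\<close> flat, which gives both the divisibility and \<open>ok (u + 1)\<close>.\<close>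

lemma three_part_contracting:
  assumes k3: "3 \<le> k" and k6: "k mod 6 \<in> {0, 2, 5}" and n: "1 \<le> n" "n \<le> N" "n \<le> 17"
  shows "gcd 9 (int n + 1) dvd numer n"
proof (cases "n = 1")
  case True then show ?thesis by simp
next
  case False
  then have N: "2 \<le> N" using n by simp
  have one: "[G m ^ (k - 1) = 1] (mod 9)" if m: "G m mod 9 = 1 \<or> k mod 6 = 5 \<and> G m mod 9 = 8" for m
  proof -
    have "\<not> 3 dvd G m" using m by presburger
    moreover have "k mod 6 = 5 \<Longrightarrow> (k - 1) mod 6 = 4" using pred_mod_6 by simp
    ultimately show ?thesis using unit_power_mod_9[of "G m" "k - 1"] m by (auto simp: cong_def)
  qed
  have X2: "numer 2 mod 9 = (if k mod 6 = 0 then 3 else 6)"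
  proof -
    have "[numer 2 = 2 * (G 2 mod 9) + G 2 ^ k mod 9] (mod 9)"
      unfolding numer_def of_nat_numeral by (intro cong_add cong_mult cong_refl) (simp_all add: cong_def)
    then have numer: "numer 2 mod 9 = (2 * (G 2 mod 9) + G 2 ^ k mod 9) mod 9"
      by (simp only: cong_def)
    have sq: "9 dvd G 2 ^ k" if "3 dvd G 2"
    proof -
      have "3 ^ 2 dvd G 2 ^ 2" using that by (intro dvd_power_same)
      also have "G 2 ^ 2 dvd G 2 ^ k" using k by (rule le_imp_power_dvd)
      finally show ?thesis by simp
    qed
    have pred6: "(k - 1) mod 6 = (if k mod 6 = 0 then 5 else k mod 6 - 1)"
      using k by (cases k) (auto simp: mod_Suc split: if_splits)
    consider "k mod 6 = 0" "(k - 1) mod 6 = 5" | "k mod 6 = 2" "(k - 1) mod 6 = 1"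
      | "k mod 6 = 5" "(k - 1) mod 6 = 4"
      using k6 pred6 by fastforce
    then show ?thesis
    proof cases
      case 1
      have g: "G 2 mod 9 = 6" using G2_mod_9[OF N] unfolding 1(2) by simp
      then have "9 dvd G 2 ^ k" by (intro sq) presburger
      then have "G 2 ^ k mod 9 = 0" by simp
      then show ?thesis unfolding numer g 1(1) by simp
    next
      case 2
      have g: "G 2 mod 9 = 3" using G2_mod_9[OF N] unfolding 2(2) by simp
      then have "9 dvd G 2 ^ k" by (intro sq) presburger
      then have "G 2 ^ k mod 9 = 0" by simp
      then show ?thesis unfolding numer g 2(1) by simp
    next
      case 3
      have g: "G 2 mod 9 = 8" using G2_mod_9[OF N] unfolding 3(2) by simp
      then have "\<not> 3 dvd G 2" by presburger
      from numer_mod_9[OF this] show ?thesis unfolding g 3(1) by (simp add: cong_def)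
    qed
  qed
  define ok where "ok u \<longleftrightarrow> 27 dvd int (3 * u) * G (3 * u) \<or> \<not> 3 dvd G (3 * u) \<and>
    (k mod 6 = 5 \<or> G (3 * u) mod 3 = 1 \<or> u = 3 \<or> k mod 6 = 2 \<and> u = 1)" for u
  have ok: "ok u" if "1 \<le> u" "3 * u \<le> N" "u \<le> 5" for u
    using that
  proof (induction u rule: dec_induct)
    case base
    then have "3 * G 3 = numer 2" using rec_numer[of 2] by simp
    then have "G 3 mod 3 = (if k mod 6 = 0 then 1 else 2)" using X2 by (auto split: if_splits) presburger+
    then show ?case using k6 by (auto simp: ok_def split: if_splits)
  next
    case (step u)
    then consider "27 dvd int (3 * u) * G (3 * u)" | "\<not> 3 dvd G (3 * u)"
      "k mod 6 = 5 \<or> G (3 * u) mod 3 = 1 \<or> u = 3 \<or> k mod 6 = 2 \<and> u = 1"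
      unfolding ok_def by auto
    then show ?case
    proof cases
      case 1
      then show ?thesis unfolding ok_def using dead_persists[OF k3 1, of "3 * Suc u"] step(1,4,5) by simp
    next
      case 2
      have g: "G (3 * u + 2) mod 9 = 1 \<or> k mod 6 = 5 \<and> G (3 * u + 2) mod 9 = 8"
        using step 2 by (intro contraction k6) auto
      show ?thesis
      proof (cases "u = 2")
        case True
        then show ?thesis using mult_dvd_mono[of 9 9 3 "G 9"] by (auto simp: ok_def)
      next
        case False
        have "[G (3 * u + 2 + 1) = G (3 * u + 2)] (mod 3)"
        proof (rule flat_step(2)[OF _ one[OF g]])
          show "\<not> 9 dvd int (3 * u + 2) + 1" using False step by simp presburger
        qed (use step in auto)
        moreover have "3 * u + 2 + 1 = 3 * Suc u" by simp
        ultimately have "G (3 * Suc u) mod 3 = G (3 * u + 2) mod 3" by (simp only: cong_def)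
        then have "G (3 * Suc u) mod 3 = 1 \<or> k mod 6 = 5 \<and> G (3 * Suc u) mod 3 = 2"
          using g by presburger
        moreover from this have "\<not> 3 dvd G (3 * Suc u)" by presburger
        ultimately show ?thesis unfolding ok_def by blast
      qed
    qed
  qed
  consider "n mod 3 \<noteq> 2" | "n = 2" | u where "n = 3 * u + 2" "1 \<le> u"
  proof -
    have "n = 3 * (n div 3) + n mod 3" by simp
    then show ?thesis using that by (cases "n div 3 = 0") fastforce+
  qed
  then show ?thesis
  proof cases
    case 1
    then have "\<not> 3 dvd int n + 1" by presburger
    then have "coprime 9 (int n + 1)" unfolding coprime_9_iff .
    then show ?thesis by simp
  next
    case 2
    have "3 dvd numer 2" using X2 by (auto split: if_splits) presburger+
    then show ?thesis using 2 by simp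
  next
    case 3
    then consider "27 dvd int (3 * u) * G (3 * u)" | "\<not> 3 dvd G (3 * u)"
      "k mod 6 = 5 \<or> G (3 * u) mod 3 = 1 \<or> u = 3 \<or> k mod 6 = 2 \<and> u = 1"
      using ok[of u] n unfolding ok_def by auto
    then show ?thesis
    proof cases
      case 1
      then show ?thesis using dead[of "3 * u" n] 3 n k3 by simp
    next
      case 2
      have "G n mod 9 = 1 \<or> k mod 6 = 5 \<and> G n mod 9 = 8"
        unfolding 3(1) using 2 3 n by (intro contraction k6) auto
      then show ?thesis using n(1) by (intro flat_step(1) one)
    qed
  qed
qed

lemma three_part:
  assumes "3 \<le> k" "1 \<le> n" "n \<le> N" "n \<le> 17"
  shows "gcd 9 (int n + 1) dvd numer n"
proof -
  have "k mod 6 \<in> {0, 2, 5} \<or> k mod 6 = 1 \<or> k mod 6 = 3 \<or> k mod 6 = 4" by simp presburger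
  then show ?thesis
  proof (elim disjE)
    assume "k mod 6 \<in> {0, 2, 5}"
    then show ?thesis by (rule three_part_contracting[OF assms(1) _ assms(2-)])
  next
    assume "k mod 6 = 1"
    then show ?thesis by (rule three_part_unit_powers[OF assms(1) _ assms(2-)])
  next
    assume "k mod 6 = 3"
    then show ?thesis by (rule three_part_dead[OF assms(1) _ assms(2-)])
  next
    assume "k mod 6 = 4"
    then show ?thesis by (rule three_part_dormant[OF assms(1) _ assms(2-)])
  qed
qed

end

section \<open>Following the sequence modulo a prime power\<close>

text \<open>Repeated squaring on binary integers keeps the evaluation by rewriting short.\<close>

function pow_mod :: "int \<Rightarrow> int \<Rightarrow> int \<Rightarrow> int" where
  "pow_mod M a n = (if n \<le> 0 then 1 mod M
     else if n mod 2 = 0 then pow_mod M (a * a mod M) (n div 2)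
     else a * pow_mod M (a * a mod M) (n div 2) mod M)"
  by auto
termination by (relation "measure (\<lambda>(_, _, n). nat n)") auto
declare pow_mod.simps [simp del]

lemma pow_mod_eq: "pow_mod M a n = a ^ nat n mod M"
proof (induction M a n rule: pow_mod.induct)
  case (1 M a n)
  show ?case
  proof (cases "n \<le> 0")
    case True
    then show ?thesis by (simp add: pow_mod.simps)
  next
    case False
    define h where "h = nat (n div 2)"
    have sq: "(a * a mod M) ^ h mod M = a ^ (2 * h) mod M"
      by (simp add: power_mod power_mult power2_eq_square)
    show ?thesis
    proof (cases "n mod 2 = 0")
      case True
      have "int h = n div 2" using False by (simp add: h_def)
      then have "n = 2 * int h" using True by presburger
      then have "nat n = 2 * h" by linarith
      then show ?thesis using 1(1) False True sq by (simp add: pow_mod.simps[of M a n] h_def)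
    next
      case odd: False
      have "int h = n div 2" using False by (simp add: h_def)
      then have "n = 2 * int h + 1" using odd by presburger
      then have "nat n = Suc (2 * h)" by linarith
      moreover have "pow_mod M a n = a * ((a * a mod M) ^ h mod M) mod M"
        using 1(2) False odd by (simp add: pow_mod.simps[of M a n] h_def)
      ultimately show ?thesis by (simp add: sq mod_mult_right_eq)
    qed
  qed
qed

text \<open>A solution \<open>b\<close> of \<open>m * b \<equiv> x\<close> modulo \<open>M\<close>, if there is one.\<close>

definition quotient_mod :: "int \<Rightarrow> int \<Rightarrow> int \<Rightarrow> int option" where
  "quotient_mod M m x = map_option (\<lambda>t. (x + t * M) div m) (find (\<lambda>t. m dvd x + t * M) [0..m - 1])"

lemma quotient_mod_SomeD:
  assumes "quotient_mod M m x = Some b"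
  shows "[m * b = x] (mod M)"
proof -
  from assms obtain t where "m dvd x + t * M" "b = (x + t * M) div m"
    by (auto simp: quotient_mod_def find_Some_iff)
  then have "m * b = x + t * M" by simp
  then show ?thesis by (simp add: cong_def)
qed

text \<open>\<open>goebel_mod q \<kappa> f n M a\<close> follows \<open>f\<close> steps of the recursion with exponent \<open>\<kappa>\<close> from \<open>g n \<equiv> a\<close> modulo \<open>M\<close>, and
  returns the last modulus and residue. It fails when the remaining modulus \<open>M\<close>, a divisor of the initial modulus \<open>q\<close>,
  has become too small to decide divisibility by the \<open>q\<close>-part of \<open>n + 1\<close>, or when this divisibility is
  violated.\<close>

fun goebel_mod :: "int \<Rightarrow> int \<Rightarrow> nat \<Rightarrow> int \<Rightarrow> int \<Rightarrow> int \<Rightarrow> (int \<times> int) option" where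
  "goebel_mod q \<kappa> 0 n M a = Some (M, a)"
| "goebel_mod q \<kappa> (Suc f) n M a =
    (if gcd q (n + 1) dvd M then
      (case quotient_mod M (n + 1) ((n * a + pow_mod M a \<kappa>) mod M) of
        None \<Rightarrow> None
      | Some b \<Rightarrow> goebel_mod q \<kappa> f (n + 1) (M div gcd M (n + 1)) b)
     else None)"

lemma cong_cancel_gcd:
  fixes m x y M :: int
  assumes "[m * x = m * y] (mod M)" "M \<noteq> 0"
  shows "[x = y] (mod M div gcd M m)"
proof -
  obtain M' m' where M: "M = M' * gcd M m" and m: "m = m' * gcd M m" and co: "coprime M' m'"
    using gcd_coprime_exists[of M m] assms(2) by auto
  have "M dvd m * (x - y)"
    using assms(1) by (simp add: cong_iff_dvd_diff right_diff_distrib)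
  then have "M' * gcd M m dvd m' * (x - y) * gcd M m"
    using M m by (metis mult.assoc mult.commute)
  then have "M' dvd m' * (x - y)"
    using assms(2) by simp
  then have "M' dvd x - y"
    using co by (simp add: coprime_dvd_mult_right_iff)
  moreover have "M div gcd M m = M'"
    using M assms(2) by (metis gcd_eq_0_iff nonzero_mult_div_cancel_right)
  ultimately show ?thesis
    by (simp add: cong_iff_dvd_diff)
qed

context goebel_prefix
begin

text \<open>If the congruence \<open>(n + 1) b \<equiv> numer n\<close> modulo \<open>M\<close> is solvable, then every common divisor of \<open>M\<close> and
  \<open>n + 1\<close> divides \<open>numer n\<close>. Only the congruence between powers with the exponents \<open>k\<close> and \<open>\<kappa>\<close> modulo \<open>q\<close> is used, so a
  single run covers a whole class of exponents.\<close>

lemma goebel_mod_sound: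
  assumes run: "goebel_mod q \<kappa> f (int n) M a = Some (M', c)"
    and q: "q \<noteq> 0" "M dvd q" and pow: "\<And>x :: int. [x ^ k = x ^ nat \<kappa>] (mod q)"
    and a: "[G n = a] (mod M)" and n: "1 \<le> n"
  shows "(\<forall>i<f. n + i \<le> N \<longrightarrow> gcd q (int (n + i) + 1) dvd numer (n + i)) \<and>
    (n + f \<le> N \<longrightarrow> [G (n + f) = c] (mod M'))"
  using run q(2) a n
proof (induction f arbitrary: n M a)
  case 0
  then show ?case by simp
next
  case (Suc f)
  define x where "x = (int n * a + pow_mod M a \<kappa>) mod M"
  from Suc.prems(1) obtain b where dvd: "gcd q (int n + 1) dvd M"
    and b: "quotient_mod M (int n + 1) x = Some b"
    and run': "goebel_mod q \<kappa> f (int (n + 1)) (M div gcd M (int n + 1)) b = Some (M', c)"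
    by (auto simp: x_def ac_simps split: if_splits option.splits)
  have "[G n ^ k = a ^ nat \<kappa>] (mod M)"
    using cong_trans[OF cong_dvd_modulus[OF pow Suc.prems(2)] cong_pow[OF Suc.prems(3)]] .
  then have Xx: "[numer n = x] (mod M)"
    unfolding numer_def x_def pow_mod_eq cong_mod_right
    by (metis (no_types) Suc.prems(3) cong_add cong_mod_right cong_refl cong_mult)
  have Xb: "[(int n + 1) * b = numer n] (mod M)"
    using cong_trans[OF quotient_mod_SomeD[OF b] cong_sym[OF Xx]] .
  have here: "gcd q (int n + 1) dvd numer n"
    using cong_dvd_iff[OF cong_dvd_modulus[OF Xb dvd]] by simp
  have later: "(\<forall>i<f. n + 1 + i \<le> N \<longrightarrow> gcd q (int (n + 1 + i) + 1) dvd numer (n + 1 + i)) \<and>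
    (n + 1 + f \<le> N \<longrightarrow> [G (n + 1 + f) = c] (mod M'))" if "n < N"
  proof (rule Suc.IH[OF run'])
    show "M div gcd M (int n + 1) dvd q"
      using Suc.prems(2) dvd_trans[of "M div gcd M (int n + 1)" M q]
        dvd_triv_left[of "M div gcd M (int n + 1)" "gcd M (int n + 1)"] by simp
    have "[(int n + 1) * G (n + 1) = (int n + 1) * b] (mod M)"
      unfolding rec_numer[OF Suc.prems(4) that] by (rule cong_sym[OF Xb])
    then show "[G (n + 1) = b] (mod M div gcd M (int n + 1))"
      using q(1) Suc.prems(2) by (intro cong_cancel_gcd) auto
  qed simp
  show ?case
  proof (intro conjI allI impI)
    fix i assume i: "i < Suc f" "n + i \<le> N"
    show "gcd q (int (n + i) + 1) dvd numer (n + i)"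
    proof (cases i)
      case 0 then show ?thesis using here by simp
    next
      case (Suc i') then show ?thesis using later i by (auto simp: ac_simps)
    qed
  next
    assume "n + Suc f \<le> N"
    then show "[G (n + Suc f) = c] (mod M')" using later by simp
  qed
qed

lemma part_from_check:
  assumes check: "\<not> Option.is_none (goebel_mod q (int \<kappa>) 17 1 q 2)"
    and q: "q \<noteq> 0" and pow: "\<And>x :: int. [x ^ k = x ^ \<kappa>] (mod q)"
    and n: "1 \<le> n" "n \<le> N" "n \<le> 17"
  shows "gcd q (int n + 1) dvd numer n"
proof -
  obtain M c where "goebel_mod q (int \<kappa>) 17 (int 1) q 2 = Some (M, c)"
    using check by (auto simp: Option.is_none_def)
  from goebel_mod_sound[OF this q] have "\<forall>i<17. 1 + i \<le> N \<longrightarrow> gcd q (int (1 + i) + 1) dvd numer (1 + i)"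
    using pow G1 by simp
  from this[rule_format, of "n - 1"] show ?thesis using n by simp
qed

lemma prime_part_from_checks:
  assumes check: "list_all (\<lambda>\<kappa>. \<not> Option.is_none (goebel_mod q \<kappa> 17 1 q 2)) [2..m]"
    and p: "prime p" "0 < e" "e \<le> c" "2 \<le> c" and q: "q = int p ^ e"
    and m: "m = int (c + p ^ (e - 1) * (p - 1)) - 1"
    and n: "1 \<le> n" "n \<le> N" "n \<le> 17"
  shows "gcd q (int n + 1) dvd numer n"
proof -
  obtain \<kappa> where \<kappa>: "\<kappa> \<in> {2..<c + p ^ (e - 1) * (p - 1)}" "\<And>x :: int. [x ^ k = x ^ \<kappa>] (mod int p ^ e)"
    using exponent_representative[OF p k] by blast
  then have "2 \<le> int \<kappa>" "int \<kappa> \<le> m"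
    unfolding m atLeastLessThan_iff by linarith+
  then have "int \<kappa> \<in> set [2..m]" by simp
  then have "\<not> Option.is_none (goebel_mod q (int \<kappa>) 17 1 q 2)"
    using check unfolding list_all_iff by blast
  then show ?thesis
    using \<kappa>(2) p(1) n unfolding q by (intro part_from_check) (auto simp: prime_gt_0_nat)
qed

end

section \<open>The finite computations\<close>

text \<open>The \<open>17\<close> steps lead from \<open>g 1\<close> to \<open>g 18\<close>. For \<open>p = 5, 7, 11, 13, 17\<close> the modulus is the \<open>p\<close>-part of
  \<open>18!\<close>, and the exponents are all representatives that \<open>exponent_representative\<close> can yield.\<close>

lemma residue_check_125: "list_all (\<lambda>\<kappa>. \<not> Option.is_none (goebel_mod 125 \<kappa> 17 1 125 2)) [2..102]"
  by code_simp

lemma residue_check_49: "list_all (\<lambda>\<kappa>. \<not> Option.is_none (goebel_mod 49 \<kappa> 17 1 49 2)) [2..43]"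
  by code_simp

lemma residue_check_11: "list_all (\<lambda>\<kappa>. \<not> Option.is_none (goebel_mod 11 \<kappa> 17 1 11 2)) [2..11]"
  by code_simp

lemma residue_check_13: "list_all (\<lambda>\<kappa>. \<not> Option.is_none (goebel_mod 13 \<kappa> 17 1 13 2)) [2..13]"
  by code_simp

lemma residue_check_17: "list_all (\<lambda>\<kappa>. \<not> Option.is_none (goebel_mod 17 \<kappa> 17 1 17 2)) [2..17]"
  by code_simp

text \<open>Exponents from \<open>16\<close> on are the subject of \<open>two_part_large_exponent\<close>.\<close>

lemma residue_check_65536: "list_all (\<lambda>\<kappa>. \<not> Option.is_none (goebel_mod 65536 \<kappa> 17 1 65536 2)) [2..15]"
  by code_simp

text \<open>The exponent \<open>2\<close> is too small for dead sequences to stay dead modulo \<open>27\<close>, hence this separate run.\<close>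

lemma residue_check_6561: "\<not> Option.is_none (goebel_mod 6561 2 17 1 6561 2)"
  by code_simp

text \<open>Precision modulo \<open>19\<close> is kept up to \<open>g 18\<close>, so the run decides whether \<open>19\<close> divides \<open>18 g 18 + (g 18)^k\<close>.\<close>

lemma residue_check_19:
  "list_all (\<lambda>\<kappa>. case goebel_mod 19 \<kappa> 17 1 19 2 of None \<Rightarrow> False | Some (M, c) \<Rightarrow>
     M = 19 \<and> ((18 * c + pow_mod 19 c \<kappa>) mod 19 = 0 \<longleftrightarrow> \<kappa> mod 18 \<noteq> 6 \<and> \<kappa> mod 18 \<noteq> 14)) [2..19]"
  by code_simp

section \<open>Assembling the prime powers\<close>

lemma gcd_mult_dvd:
  fixes a b m x :: int
  assumes "coprime a b" "gcd a m dvd x" "gcd b m dvd x"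
  shows "gcd (a * b) m dvd x"
proof -
  obtain u v where uv: "gcd (a * b) m = u * v" "u dvd a" "v dvd b"
    using division_decomp[of "gcd (a * b) m" a b] by auto
  have "u * v dvd m" by (metis uv(1) gcd_dvd2)
  then have "u dvd gcd a m" "v dvd gcd b m"
    using uv by (auto intro: dvd_mult_left dvd_mult_right)
  then have "gcd (a * b) m dvd gcd a m * gcd b m"
    unfolding uv(1) by (rule mult_dvd_mono)
  also have "coprime (gcd a m) (gcd b m)"
    using assms(1) by (rule coprime_divisors[rotated 2]) simp_all
  then have "gcd a m * gcd b m dvd x" using assms(2,3) by (intro divides_mult)
  finally show ?thesis .
qed

lemma divisor_check: "list_all (\<lambda>m. m dvd (65536 * 9 * 125 * 49 * 11 * 13 * 17 :: int)) [2..18]"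
  by code_simp

context goebel_prefix
begin

lemma Suc_dvd_numer:
  assumes n: "1 \<le> n" "n \<le> N" "n \<le> 17"
  shows "int n + 1 dvd numer n"
proof -
  have 2: "gcd 65536 (int n + 1) dvd numer n"
  proof (cases "16 \<le> k")
    case True
    then show ?thesis using two_part_large_exponent n by simp
  next
    case False
    then have "2 \<le> int k" "int k \<le> 15" using k by linarith+
    then have "int k \<in> set [2..15]" by (simp only: set_upto atLeastAtMost_iff)
    then have "\<not> Option.is_none (goebel_mod 65536 (int k) 17 1 65536 2)"
      using residue_check_65536 unfolding list_all_iff by blast
    then show ?thesis using n by (intro part_from_check) auto
  qed
  have 3: "gcd 9 (int n + 1) dvd numer n"
  proof (cases "3 \<le> k")
    case True
    then show ?thesis using three_part n by simp
  next
    case False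
    then have "k = 2" using k by simp
    then have "gcd 6561 (int n + 1) dvd numer n"
      using residue_check_6561 n by (intro part_from_check[of _ 2]) auto
    moreover have "gcd 9 (int n + 1) dvd gcd 6561 (int n + 1)" by (intro gcd_mono) simp_all
    ultimately show ?thesis by (rule dvd_trans[rotated])
  qed
  have 5: "gcd 125 (int n + 1) dvd numer n"
    by (rule prime_part_from_checks[OF residue_check_125, of 5 3 3]) (use n in simp_all)
  have 7: "gcd 49 (int n + 1) dvd numer n"
    by (rule prime_part_from_checks[OF residue_check_49, of 7 2 2]) (use n in simp_all)
  have 11: "gcd 11 (int n + 1) dvd numer n"
    by (rule prime_part_from_checks[OF residue_check_11, of 11 1 2]) (use n in simp_all)
  have 13: "gcd 13 (int n + 1) dvd numer n"
    by (rule prime_part_from_checks[OF residue_check_13, of 13 1 2]) (use n in simp_all)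
  have 17: "gcd 17 (int n + 1) dvd numer n"
    by (rule prime_part_from_checks[OF residue_check_17, of 17 1 2]) (use n in simp_all)
  have "gcd (65536 * 9 * 125 * 49 * 11 * 13 * 17) (int n + 1) dvd numer n"
    by (intro gcd_mult_dvd 2 3 5 7 11 13 17) (simp_all add: coprime_iff_gcd_eq_1 gcd_non_0_int)
  moreover have "2 \<le> int n + 1" "int n + 1 \<le> 18" using n by linarith+
  then have "int n + 1 \<in> set [2..18]" by (simp only: set_upto atLeastAtMost_iff)
  then have "int n + 1 dvd 65536 * 9 * 125 * 49 * 11 * 13 * 17"
    using divisor_check unfolding list_all_iff by blast
  then have "int n + 1 dvd gcd (65536 * 9 * 125 * 49 * 11 * 13 * 17) (int n + 1)"
    by (rule gcd_greatest) simp
  ultimately show ?thesis by (rule dvd_trans[rotated])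
qed

lemma nineteen_dvd_numer:
  assumes "18 \<le> N"
  shows "19 dvd numer 18 \<longleftrightarrow> k mod 18 \<noteq> 6 \<and> k mod 18 \<noteq> 14"
proof -
  obtain \<kappa> where \<kappa>: "\<kappa> \<in> {2..<2 + 19 ^ (1 - 1) * (19 - 1)}" "[k = \<kappa>] (mod 19 ^ (1 - 1) * (19 - 1))"
    "\<And>x :: int. [x ^ k = x ^ \<kappa>] (mod int 19 ^ 1)"
    using exponent_representative[of 19 1 2 k] k by auto
  then have "2 \<le> int \<kappa>" "int \<kappa> \<le> 19" by simp_all
  then have "int \<kappa> \<in> set [2..19]" by (simp only: set_upto atLeastAtMost_iff)
  note bspec[OF residue_check_19[unfolded list_all_iff] this]
  then obtain c where run: "goebel_mod 19 (int \<kappa>) 17 1 19 2 = Some (19, c)"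
    and c: "(18 * c + pow_mod 19 c (int \<kappa>)) mod 19 = 0 \<longleftrightarrow> int \<kappa> mod 18 \<noteq> 6 \<and> int \<kappa> mod 18 \<noteq> 14"
    by (auto split: option.splits)
  have "[G 18 = c] (mod 19)"
    using goebel_mod_sound[of 19 "int \<kappa>" 17 1 19 2 19 c] run \<kappa>(3) G1 assms by simp
  then have "[numer 18 = 18 * c + c ^ \<kappa>] (mod 19)"
    unfolding numer_def of_nat_numeral using cong_trans[OF \<kappa>(3) cong_pow]
    by (intro cong_add cong_mult cong_refl) simp_all
  then have "19 dvd numer 18 \<longleftrightarrow> (18 * c + pow_mod 19 c (int \<kappa>)) mod 19 = 0"
    by (simp add: cong_def pow_mod_eq mod_add_right_eq dvd_eq_mod_eq_0)
  moreover have "int \<kappa> mod 18 = int (k mod 18)"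
    using \<kappa>(2) by (simp add: cong_def zmod_int)
  ultimately show ?thesis using c by simp
qed

end

section \<open>Integrality of the rational sequence\<close>

lemma goebel_step:
  assumes "1 \<le> n"
  shows "of_nat (n + 1) * goebel k (n + 1) = of_nat n * goebel k n + goebel k n ^ k"
proof -
  have sum: "of_nat (Suc m) * goebel k (Suc m) = 1 + (\<Sum>j = 0..<Suc m. goebel k j ^ k)" for m
    by simp
  obtain m where "n = Suc m" using assms by (cases n) auto
  then show ?thesis using sum[of n] sum[of m] by (simp del: goebel.simps of_nat_Suc)
qed

lemma goebel_prefix_floor:
  assumes "2 \<le> k" "1 \<le> N" and int: "\<And>n. n \<le> N \<Longrightarrow> goebel k n \<in> \<int>"
  shows "goebel_prefix k N (\<lambda>n. \<lfloor>goebel k n\<rfloor>)"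
proof
  show "\<lfloor>goebel k 1\<rfloor> = 2" by simp
  fix n assume "1 \<le> n" "n < N"
  then have "goebel k n = of_int \<lfloor>goebel k n\<rfloor>" "goebel k (n + 1) = of_int \<lfloor>goebel k (n + 1)\<rfloor>"
    using int[of n] int[of "n + 1"] by (auto elim!: Ints_cases simp del: goebel.simps)
  with goebel_step[OF \<open>1 \<le> n\<close>, of k]
  have "of_int ((int n + 1) * \<lfloor>goebel k (n + 1)\<rfloor>) =
      (of_int (int n * \<lfloor>goebel k n\<rfloor> + \<lfloor>goebel k n\<rfloor> ^ k) :: rat)"
    by (simp add: add.commute del: goebel.simps)
  then show "(int n + 1) * \<lfloor>goebel k (n + 1)\<rfloor> = int n * \<lfloor>goebel k n\<rfloor> + \<lfloor>goebel k n\<rfloor> ^ k"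
    by (simp only: of_int_eq_iff)
qed (fact assms)

lemma goebel_next_integral_iff:
  assumes "2 \<le> k" "1 \<le> N" and int: "\<And>n. n \<le> N \<Longrightarrow> goebel k n \<in> \<int>"
  shows "goebel k (N + 1) \<in> \<int> \<longleftrightarrow> int N + 1 dvd goebel_prefix.numer k (\<lambda>n. \<lfloor>goebel k n\<rfloor>) N"
proof -
  interpret goebel_prefix k N "\<lambda>n. \<lfloor>goebel k n\<rfloor>"
    using assms by (rule goebel_prefix_floor)
  have "goebel k N = of_int \<lfloor>goebel k N\<rfloor>"
    using int[of N] by (auto elim!: Ints_cases simp del: goebel.simps)
  with goebel_step[OF \<open>1 \<le> N\<close>, of k]
  have eq: "of_int (int N + 1) * goebel k (N + 1) = of_int (numer N)"
    by (simp add: numer_def add.commute del: goebel.simps)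
  show ?thesis
  proof
    assume "goebel k (N + 1) \<in> \<int>"
    then obtain z where "goebel k (N + 1) = of_int z" by (auto elim: Ints_cases)
    with eq have "of_int ((int N + 1) * z) = (of_int (numer N) :: rat)" by (simp only: of_int_mult)
    then show "int N + 1 dvd numer N" by (simp only: of_int_eq_iff) (metis dvd_triv_left)
  next
    assume "int N + 1 dvd numer N"
    then obtain z where "numer N = (int N + 1) * z" by (elim dvdE)
    with eq have "of_int (int N + 1) * goebel k (N + 1) = of_int (int N + 1) * of_int z"
      by (simp only: of_int_mult)
    then have "goebel k (N + 1) = of_int z"
      by (subst (asm) mult_cancel_left) (simp del: goebel.simps of_int_add)
    then show "goebel k (N + 1) \<in> \<int>" by simp
  qed
qed

lemma goebel_integral:
  assumes "2 \<le> k" "n \<le> 18"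
  shows "goebel k n \<in> \<int>"
  using assms(2)
proof (induction n rule: less_induct)
  case (less n)
  consider "n = 0" | "n = 1" | N where "n = N + 1" "1 \<le> N"
    by (cases n) fastforce+
  then show ?case
  proof cases
    case (3 N)
    then have int: "goebel k m \<in> \<int>" if "m \<le> N" for m
      using less that by simp
    interpret goebel_prefix k N "\<lambda>n. \<lfloor>goebel k n\<rfloor>"
      using assms(1) 3(2) int by (rule goebel_prefix_floor)
    show ?thesis
      using goebel_next_integral_iff[OF assms(1) 3(2) int] Suc_dvd_numer[of N] 3 less.prems by simp
  qed simp_all
qed

lemma goebel_19_integral_iff:
  assumes "2 \<le> k"
  shows "goebel k 19 \<in> \<int> \<longleftrightarrow> k mod 18 \<noteq> 6 \<and> k mod 18 \<noteq> 14"
proof -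
  interpret goebel_prefix k 18 "\<lambda>n. \<lfloor>goebel k n\<rfloor>"
    using assms goebel_integral by (intro goebel_prefix_floor) simp_all
  show ?thesis
    using goebel_next_integral_iff[of k 18] goebel_integral[OF assms] nineteen_dvd_numer assms
    by (simp del: goebel.simps)
qed

lemma goebel_N_ge_19:
  assumes "2 \<le> k"
  shows "19 \<le> goebel_N k"
  unfolding goebel_N_def
proof (rule Inf_greatest)
  fix x assume "x \<in> enat ` {n. goebel k n \<notin> \<int>}"
  then obtain n where "x = enat n" "goebel k n \<notin> \<int>" by auto
  moreover from this have "19 \<le> n" using goebel_integral[OF assms, of n] by linarith
  ultimately show "19 \<le> x" by (simp add: numeral_eq_enat)
qed

lemma goebel_N_eq_19_iff:
  assumes "2 \<le> k"
  shows "goebel_N k = 19 \<longleftrightarrow> goebel k 19 \<notin> \<int>"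
proof
  assume N: "goebel_N k = 19"
  have "{n. goebel k n \<notin> \<int>} \<noteq> {}"
  proof
    assume "{n. goebel k n \<notin> \<int>} = {}"
    then have "goebel_N k = \<infinity>" unfolding goebel_N_def Inf_enat_def by (simp del: goebel.simps)
    then show False using N by simp
  qed
  then have "goebel_N k \<in> enat ` {n. goebel k n \<notin> \<int>}"
    unfolding goebel_N_def Inf_enat_def by (auto intro: LeastI)
  then show "goebel k 19 \<notin> \<int>" unfolding N by (auto simp: numeral_eq_enat simp del: goebel.simps)
next
  assume "goebel k 19 \<notin> \<int>"
  then have "goebel_N k \<le> enat 19"
    unfolding goebel_N_def by (intro Inf_lower) (simp del: goebel.simps)
  then show "goebel_N k = 19" using goebel_N_ge_19[OF assms] by (simp add: numeral_eq_enat)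
qed

theorem theorem1p2:
  shows "(LEAST m. m \<in> goebel_N ` {k. 2 \<le> k}) = 19 \<and>
    (\<forall>k n. 2 \<le> k \<longrightarrow> n \<le> 18 \<longrightarrow> goebel k n \<in> \<int>) \<and>
    (\<forall>k. 2 \<le> k \<longrightarrow> (goebel_N k = 19 \<longleftrightarrow> [k = 6] (mod 18) \<or> [k = 14] (mod 18)))"
proof (intro conjI)
  show iff: "\<forall>k. 2 \<le> k \<longrightarrow> (goebel_N k = 19 \<longleftrightarrow> [k = 6] (mod 18) \<or> [k = 14] (mod 18))"
    by (auto simp: goebel_N_eq_19_iff goebel_19_integral_iff cong_def simp del: goebel.simps)
  show "\<forall>k n. 2 \<le> k \<longrightarrow> n \<le> 18 \<longrightarrow> goebel k n \<in> \<int>"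
    using goebel_integral by blast
  show "(LEAST m. m \<in> goebel_N ` {k. 2 \<le> k}) = 19"
  proof (rule Least_equality)
    have "goebel_N 6 = 19" using iff by (simp add: cong_def)
    then show "19 \<in> goebel_N ` {k. 2 \<le> k}" by force
  qed (auto simp: goebel_N_ge_19)
qed

end
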